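(* Let $\mathbf{A}_1$ and $\mathbf{A}_2$ be two first order structures on the same finite set $A$. For each $i\in\{1,2\}$, let $\Phi_i$ be a set of first order formulas in the language of $\mathbf{A}_i$ that is closed under $\wedge$, under $\vee$, and under taking minors of formulas. Then $\mathrm{Def}(\mathbf{A}_1,\Phi_1)=\mathrm{Def}(\mathbf{A}_2,\Phi_2)$ if and only if $\mathrm{Def}^{[|A|^2]}(\mathbf{A}_1,\Phi_1)=\mathrm{Def}^{[|A|^2]}(\mathbf{A}_2,\Phi_2)$.
   Context: First order formulas are formulas of first order logic with equality $\approx$ over the variable set $\{x_i\mid i\in\mathbb{N}\}$; structures may have function and relation symbols. For $n\in\mathbb{N}$, a set $B\subseteq A^n$ is $\Phi$-definable (in $\mathbf{A}$) if there is $\varphi\in\Phi$ whose free variables are all among $x_1,\dots,x_n$ with $B=\{(a_1,\dots,a_n)\in A^n\mid \mathbf{A}\models\varphi(a_1,\dots,a_n)\}$ (assignment $x_i\mapsto a_i$). $\mathrm{Def}^{[n]}(\mathbf{A},\Phi)$ is the set of $\Phi$-definable subsets of $A^n$, and $\mathrm{Def}(\mathbf{A},\Phi)=\bigcup_{n\in\mathbb{N}}\mathrm{Def}^{[n]}(\mathbf{A},\Phi)$. A formula $\varphi$ is a minor of $\varphi'$ if there are $n\in\mathbb{N}$ and $\sigma\colon\{1,\dots,n\}\to\mathbb{N}$ such that $\varphi$ is obtained from $\varphi'$ by simultaneously substituting $x_1,\dots,x_n$ by $x_{\sigma(1)},\dots,x_{\sigma(n)}$. *)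

theory Defs
  imports Main
begin

text \<open>
  Throughout, the natural numbers of the source are the positive integers: the variables are
  $x_1, x_2, \dots$, and all definable relations have arity at least 1.
  (With arity 0 admitted the theorem would be false: on every structure, the closures of
  $\{x_1 \approx x_1\}$ and of $\{\forall x_1.\, x_1 \approx x_1\}$ under conjunction,
  disjunction and minors define the same relations of each positive arity, but only the
  latter defines a nullary one.)
  Syntactically the index 0 exists as well; it is excluded by the well-formedness predicates.
\<close>

datatype 'f trm = Var nat | App 'f "'f trm list"

datatype ('f, 'r) form =
    Bot
  | Top
  | Eq "'f trm" "'f trm"
  | Rel 'r "'f trm list"
  | Neg "('f, 'r) form"
  | Conj "('f, 'r) form" "('f, 'r) form"
  | Disj "('f, 'r) form" "('f, 'r) form"
  | Imp "('f, 'r) form" "('f, 'r) form"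
  | Iff "('f, 'r) form" "('f, 'r) form"
  | Ex nat "('f, 'r) form"
  | All nat "('f, 'r) form"

text \<open>
  A structure carries its own language: the function and relation symbols are the elements in
  the domains of the arity maps, so that either set of symbols may be empty.
  Tuples are lists.
\<close>

record ('a, 'f, 'r) fo_struct =
  univ :: "'a set"
  fun_arity :: "'f \<Rightarrow> nat option"
  rel_arity :: "'r \<Rightarrow> nat option"
  fun_interp :: "'f \<Rightarrow> 'a list \<Rightarrow> 'a"
  rel_interp :: "'r \<Rightarrow> 'a list set"

definition tuples :: "nat \<Rightarrow> 'a set \<Rightarrow> 'a list set" where
  "tuples n A = {as. length as = n \<and> set as \<subseteq> A}"

definition is_structure :: "('a, 'f, 'r) fo_struct \<Rightarrow> bool" where
  "is_structure M \<longleftrightarrow>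
     univ M \<noteq> {} \<and>
     (\<forall>f n. fun_arity M f = Some n \<longrightarrow>
        (\<forall>as \<in> tuples n (univ M). fun_interp M f as \<in> univ M)) \<and>
     (\<forall>r n. rel_arity M r = Some n \<longrightarrow> rel_interp M r \<subseteq> tuples n (univ M))"

fun wf_trm :: "('a, 'f, 'r) fo_struct \<Rightarrow> 'f trm \<Rightarrow> bool" where
  "wf_trm M (Var i) \<longleftrightarrow> 1 \<le> i"
| "wf_trm M (App f ts) \<longleftrightarrow> fun_arity M f = Some (length ts) \<and> (\<forall>t \<in> set ts. wf_trm M t)"

fun wf_form :: "('a, 'f, 'r) fo_struct \<Rightarrow> ('f, 'r) form \<Rightarrow> bool" where
  "wf_form M Bot \<longleftrightarrow> True"
| "wf_form M Top \<longleftrightarrow> True"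
| "wf_form M (Eq s t) \<longleftrightarrow> wf_trm M s \<and> wf_trm M t"
| "wf_form M (Rel r ts) \<longleftrightarrow> rel_arity M r = Some (length ts) \<and> (\<forall>t \<in> set ts. wf_trm M t)"
| "wf_form M (Neg p) \<longleftrightarrow> wf_form M p"
| "wf_form M (Conj p q) \<longleftrightarrow> wf_form M p \<and> wf_form M q"
| "wf_form M (Disj p q) \<longleftrightarrow> wf_form M p \<and> wf_form M q"
| "wf_form M (Imp p q) \<longleftrightarrow> wf_form M p \<and> wf_form M q"
| "wf_form M (Iff p q) \<longleftrightarrow> wf_form M p \<and> wf_form M q"
| "wf_form M (Ex i p) \<longleftrightarrow> 1 \<le> i \<and> wf_form M p"
| "wf_form M (All i p) \<longleftrightarrow> 1 \<le> i \<and> wf_form M p"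

definition formulas :: "('a, 'f, 'r) fo_struct \<Rightarrow> ('f, 'r) form set" where
  "formulas M = {p. wf_form M p}"

fun trm_val :: "('a, 'f, 'r) fo_struct \<Rightarrow> (nat \<Rightarrow> 'a) \<Rightarrow> 'f trm \<Rightarrow> 'a" where
  "trm_val M e (Var i) = e i"
| "trm_val M e (App f ts) = fun_interp M f (map (trm_val M e) ts)"

fun sat :: "('a, 'f, 'r) fo_struct \<Rightarrow> (nat \<Rightarrow> 'a) \<Rightarrow> ('f, 'r) form \<Rightarrow> bool" where
  "sat M e Bot \<longleftrightarrow> False"
| "sat M e Top \<longleftrightarrow> True"
| "sat M e (Eq s t) \<longleftrightarrow> trm_val M e s = trm_val M e t"
| "sat M e (Rel r ts) \<longleftrightarrow> map (trm_val M e) ts \<in> rel_interp M r"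
| "sat M e (Neg p) \<longleftrightarrow> \<not> sat M e p"
| "sat M e (Conj p q) \<longleftrightarrow> sat M e p \<and> sat M e q"
| "sat M e (Disj p q) \<longleftrightarrow> sat M e p \<or> sat M e q"
| "sat M e (Imp p q) \<longleftrightarrow> (sat M e p \<longrightarrow> sat M e q)"
| "sat M e (Iff p q) \<longleftrightarrow> (sat M e p \<longleftrightarrow> sat M e q)"
| "sat M e (Ex i p) \<longleftrightarrow> (\<exists>a \<in> univ M. sat M (e(i := a)) p)"
| "sat M e (All i p) \<longleftrightarrow> (\<forall>a \<in> univ M. sat M (e(i := a)) p)"

fun fv_trm :: "'f trm \<Rightarrow> nat set" where
  "fv_trm (Var i) = {i}"
| "fv_trm (App f ts) = (\<Union>t \<in> set ts. fv_trm t)"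

fun fv :: "('f, 'r) form \<Rightarrow> nat set" where
  "fv Bot = {}"
| "fv Top = {}"
| "fv (Eq s t) = fv_trm s \<union> fv_trm t"
| "fv (Rel r ts) = (\<Union>t \<in> set ts. fv_trm t)"
| "fv (Neg p) = fv p"
| "fv (Conj p q) = fv p \<union> fv q"
| "fv (Disj p q) = fv p \<union> fv q"
| "fv (Imp p q) = fv p \<union> fv q"
| "fv (Iff p q) = fv p \<union> fv q"
| "fv (Ex i p) = fv p - {i}"
| "fv (All i p) = fv p - {i}"

text \<open>
  Simultaneous capture-avoiding substitution of variables for the free occurrences of
  variables. A bound variable is renamed only if it would capture a substituted variable, and
  then to the first variable that does not.
\<close>

fun subst_trm :: "(nat \<Rightarrow> nat) \<Rightarrow> 'f trm \<Rightarrow> 'f trm" where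
  "subst_trm s (Var i) = Var (s i)"
| "subst_trm s (App f ts) = App f (map (subst_trm s) ts)"

definition bound_name :: "(nat \<Rightarrow> nat) \<Rightarrow> nat \<Rightarrow> ('f, 'r) form \<Rightarrow> nat" where
  "bound_name s i p =
     (if i \<notin> s ` (fv p - {i}) then i else (LEAST j. 1 \<le> j \<and> j \<notin> s ` (fv p - {i})))"

fun subst :: "(nat \<Rightarrow> nat) \<Rightarrow> ('f, 'r) form \<Rightarrow> ('f, 'r) form" where
  "subst s Bot = Bot"
| "subst s Top = Top"
| "subst s (Eq t u) = Eq (subst_trm s t) (subst_trm s u)"
| "subst s (Rel r ts) = Rel r (map (subst_trm s) ts)"
| "subst s (Neg p) = Neg (subst s p)"
| "subst s (Conj p q) = Conj (subst s p) (subst s q)"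
| "subst s (Disj p q) = Disj (subst s p) (subst s q)"
| "subst s (Imp p q) = Imp (subst s p) (subst s q)"
| "subst s (Iff p q) = Iff (subst s p) (subst s q)"
| "subst s (Ex i p) = (let j = bound_name s i p in Ex j (subst (s(i := j)) p))"
| "subst s (All i p) = (let j = bound_name s i p in All j (subst (s(i := j)) p))"

definition is_minor :: "('f, 'r) form \<Rightarrow> ('f, 'r) form \<Rightarrow> bool" where
  "is_minor p p' \<longleftrightarrow>
     (\<exists>n \<ge> 1. \<exists>\<sigma>. (\<forall>i \<in> {1..n}. 1 \<le> \<sigma> i) \<and>
        p = subst (\<lambda>i. if i \<in> {1..n} then \<sigma> i else i) p')"

definition closed_conj :: "('f, 'r) form set \<Rightarrow> bool" where
  "closed_conj \<Phi> \<longleftrightarrow> (\<forall>p \<in> \<Phi>. \<forall>q \<in> \<Phi>. Conj p q \<in> \<Phi>)"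

definition closed_disj :: "('f, 'r) form set \<Rightarrow> bool" where
  "closed_disj \<Phi> \<longleftrightarrow> (\<forall>p \<in> \<Phi>. \<forall>q \<in> \<Phi>. Disj p q \<in> \<Phi>)"

definition closed_minor :: "('f, 'r) form set \<Rightarrow> bool" where
  "closed_minor \<Phi> \<longleftrightarrow> (\<forall>p' \<in> \<Phi>. \<forall>p. is_minor p p' \<longrightarrow> p \<in> \<Phi>)"

text \<open>
  Lists are indexed from 0, so the assignment $x_i \mapsto a_i$ is \<open>\<lambda>i. as ! (i - 1)\<close>. Its values
  outside \<open>{1..n}\<close> are irrelevant, as the formula has no free variables there.
\<close>

definition defined_rel :: "('a, 'f, 'r) fo_struct \<Rightarrow> nat \<Rightarrow> ('f, 'r) form \<Rightarrow> 'a list set" where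
  "defined_rel M n p = {as \<in> tuples n (univ M). sat M (\<lambda>i. as ! (i - 1)) p}"

definition Def_n ::
  "nat \<Rightarrow> ('a, 'f, 'r) fo_struct \<Rightarrow> ('f, 'r) form set \<Rightarrow> 'a list set set" where
  "Def_n n M \<Phi> = {B. \<exists>p \<in> \<Phi>. fv p \<subseteq> {1..n} \<and> B = defined_rel M n p}"

definition Def :: "('a, 'f, 'r) fo_struct \<Rightarrow> ('f, 'r) form set \<Rightarrow> 'a list set set" where
  "Def M \<Phi> = (\<Union>n \<in> {1..}. Def_n n M \<Phi>)"

end

theory Submission
  imports Defs
begin

text \<open>
  Let \<open>k = |A|\<^sup>2\<close>. Two tuples \<open>a, b\<close> of any length exhibit at most \<open>k\<close> distinct pairs
  \<open>(a\<^sub>i, b\<^sub>i)\<close>. Hence, identifying the coordinates of a definable relation \<open>B\<close> that carry the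
  same pair gives a \<open>k\<close>-ary definable relation, and spreading it out again gives a minor \<open>D\<close> that
  agrees with \<open>B\<close> at both \<open>a\<close> and \<open>b\<close>. Since \<open>B = \<Union>\<^sub>a \<Inter>\<^sub>b D\<^sub>a\<^sub>b\<close>, closure under unions,
  intersections and minors recovers \<open>B\<close> from the \<open>k\<close>-ary definable relations.
\<close>

section \<open>Dependence on free variables, and variable substitution\<close>

lemma trm_val_cong:
  "(\<And>i. i \<in> fv_trm t \<Longrightarrow> e i = e' i) \<Longrightarrow> trm_val M e t = trm_val M e' t"
proof (induction t)
  case (App f ts)
  have "trm_val M e t = trm_val M e' t" if "t \<in> set ts" for t
    using that App.prems by (intro App.IH) auto
  then have "map (trm_val M e) ts = map (trm_val M e') ts" by simp
  then show ?case by (simp only: trm_val.simps)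
qed simp

lemma sat_cong:
  "(\<And>i. i \<in> fv p \<Longrightarrow> e i = e' i) \<Longrightarrow> sat M e p = sat M e' p"
proof (induction p arbitrary: e e')
  case (Eq s t)
  have "trm_val M e s = trm_val M e' s" "trm_val M e t = trm_val M e' t"
    by (rule trm_val_cong, rule Eq.prems, simp)+
  then show ?case by simp
next
  case (Rel r ts)
  have "trm_val M e t = trm_val M e' t" if "t \<in> set ts" for t
    by (rule trm_val_cong, rule Rel.prems) (use that in auto)
  then have "map (trm_val M e) ts = map (trm_val M e') ts" by simp
  then show ?case by (simp only: sat.simps)
next
  case (Neg p)
  have "sat M e p = sat M e' p"
    by (rule Neg.IH, rule Neg.prems, simp)
  then show ?case by simp
next
  case (Conj p q)
  have "sat M e p = sat M e' p" "sat M e q = sat M e' q"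
    by (rule Conj.IH, rule Conj.prems, simp)+
  then show ?case by simp
next
  case (Disj p q)
  have "sat M e p = sat M e' p" "sat M e q = sat M e' q"
    by (rule Disj.IH, rule Disj.prems, simp)+
  then show ?case by simp
next
  case (Imp p q)
  have "sat M e p = sat M e' p" "sat M e q = sat M e' q"
    by (rule Imp.IH, rule Imp.prems, simp)+
  then show ?case by simp
next
  case (Iff p q)
  have "sat M e p = sat M e' p" "sat M e q = sat M e' q"
    by (rule Iff.IH, rule Iff.prems, simp)+
  then show ?case by simp
next
  case (Ex i p)
  have "sat M (e(i := a)) p = sat M (e'(i := a)) p" for a
    by (rule Ex.IH) (use Ex.prems in simp)
  then show ?case by simp
next
  case (All i p)
  have "sat M (e(i := a)) p = sat M (e'(i := a)) p" for a
    by (rule All.IH) (use All.prems in simp)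
  then show ?case by simp
qed simp_all

lemma finite_fv_trm: "finite (fv_trm t)"
  by (induction t) auto

lemma finite_fv: "finite (fv p)"
  by (induction p) (auto simp: finite_fv_trm)

text \<open>Only finitely many variables are free in \<open>p\<close>, so the \<open>LEAST\<close>
  in \<open>bound_name\<close> always has a witness.\<close>

lemma bound_name_fresh: "bound_name s i p \<notin> s ` (fv p - {i})"
proof (cases "i \<in> s ` (fv p - {i})")
  case True
  let ?S = "s ` (fv p - {i})"
  \<comment> \<open>\<open>0\<close> joins the avoided set because it is not an admissible variable
    index.\<close>
  have "finite (insert 0 ?S)" using finite_fv by blast
  then obtain j where "j \<notin> insert 0 ?S"
    using ex_new_if_finite infinite_UNIV_nat by blast
  then have "1 \<le> j \<and> j \<notin> ?S" by simp
  then have "(LEAST j. 1 \<le> j \<and> j \<notin> ?S) \<notin> ?S"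
    by (rule LeastI2) simp
  with True show ?thesis by (simp add: bound_name_def)
qed (simp add: bound_name_def)

lemma trm_val_subst: "trm_val M e (subst_trm s t) = trm_val M (e \<circ> s) t"
  by (induction t) (auto cong: map_cong intro!: arg_cong[where f = "fun_interp M _"])

text \<open>Freshness of \<open>j\<close> means that \<open>s\<close> sends no free variable of
  \<open>p\<close> other than \<open>i\<close> to \<open>j\<close>. Hence changing the assignment at
  \<open>j\<close> is felt only at \<open>i\<close>, and the two assignments agree on
  \<open>fv p\<close>.\<close>

lemma sat_subst_binder:
  assumes "j \<notin> s ` (fv p - {i})"
  shows "sat M (e(j := a) \<circ> s(i := j)) p = sat M ((e \<circ> s)(i := a)) p"
  using assms by (intro sat_cong) auto

text \<open>The induction varies both \<open>e\<close> and \<open>s\<close>, since a quantifier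
  updates both.\<close>

lemma sat_subst: "sat M e (subst s p) = sat M (e \<circ> s) p"
proof (induction p arbitrary: e s)
  case (Ex i p)
  show ?case
    by (simp only: subst.simps Let_def sat.simps Ex.IH sat_subst_binder[OF bound_name_fresh])
next
  case (All i p)
  show ?case
    by (simp only: subst.simps Let_def sat.simps All.IH sat_subst_binder[OF bound_name_fresh])
qed (simp_all add: trm_val_subst comp_def)

lemma fv_trm_subst: "fv_trm (subst_trm s t) = s ` fv_trm t"
  by (induction t) auto

lemma fv_subst_binder:
  fixes s :: "nat \<Rightarrow> nat"
  assumes "j \<notin> s ` (X - {i})"
  shows "(s(i := j)) ` X - {j} = s ` (X - {i})"
  using assms by (auto split: if_splits)

lemma fv_subst: "fv (subst s p) = s ` fv p"
proof (induction p arbitrary: s)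
  case (Ex i p)
  show ?case
    by (simp only: subst.simps Let_def fv.simps Ex.IH fv_subst_binder[OF bound_name_fresh])
next
  case (All i p)
  show ?case
    by (simp only: subst.simps Let_def fv.simps All.IH fv_subst_binder[OF bound_name_fresh])
qed (auto simp: fv_trm_subst)

section \<open>Closure properties of the definable relations of a fixed arity\<close>

lemma finite_tuples: "finite A \<Longrightarrow> finite (tuples n A)"
  using finite_lists_length_eq[of A n] by (simp add: tuples_def conj_commute)

lemma tuples_nonempty:
  assumes "A \<noteq> {}"
  shows "tuples n A \<noteq> {}"
proof -
  from assms obtain a where "a \<in> A" by blast
  then have "replicate n a \<in> tuples n A" by (auto simp: tuples_def)
  then show ?thesis by blast
qed

lemma Def_n_subset_tuples: "B \<in> Def_n n M \<Phi> \<Longrightarrow> B \<subseteq> tuples n (univ M)"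
  by (auto simp: Def_n_def defined_rel_def)

lemma Def_n_Int:
  assumes "closed_conj \<Phi>" "B \<in> Def_n n M \<Phi>" "C \<in> Def_n n M \<Phi>"
  shows "B \<inter> C \<in> Def_n n M \<Phi>"
proof -
  from assms obtain p q where "p \<in> \<Phi>" "fv p \<subseteq> {1..n}" "B = defined_rel M n p"
    "q \<in> \<Phi>" "fv q \<subseteq> {1..n}" "C = defined_rel M n q"
    by (auto simp: Def_n_def)
  with assms(1) have "Conj p q \<in> \<Phi>" "fv (Conj p q) \<subseteq> {1..n}"
    "B \<inter> C = defined_rel M n (Conj p q)"
    by (auto simp: closed_conj_def defined_rel_def)
  then show ?thesis unfolding Def_n_def by blast
qed

lemma Def_n_Un:
  assumes "closed_disj \<Phi>" "B \<in> Def_n n M \<Phi>" "C \<in> Def_n n M \<Phi>"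
  shows "B \<union> C \<in> Def_n n M \<Phi>"
proof -
  from assms obtain p q where "p \<in> \<Phi>" "fv p \<subseteq> {1..n}" "B = defined_rel M n p"
    "q \<in> \<Phi>" "fv q \<subseteq> {1..n}" "C = defined_rel M n q"
    by (auto simp: Def_n_def)
  with assms(1) have "Disj p q \<in> \<Phi>" "fv (Disj p q) \<subseteq> {1..n}"
    "B \<union> C = defined_rel M n (Disj p q)"
    by (auto simp: closed_disj_def defined_rel_def)
  then show ?thesis unfolding Def_n_def by blast
qed

text \<open>Composition with \<open>\<sigma>\<close>, a tuple being read as a function on positions.
  Positions count from 0, variables from 1; \<open>\<sigma>\<close> may repeat or omit
  positions.\<close>

definition reindex :: "nat \<Rightarrow> (nat \<Rightarrow> nat) \<Rightarrow> 'a list \<Rightarrow> 'a list" where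
  "reindex m \<sigma> as = map (\<lambda>i. as ! \<sigma> i) [0..<m]"

lemma reindex_tuples:
  assumes "\<And>i. i < m \<Longrightarrow> \<sigma> i < n" "as \<in> tuples n A"
  shows "reindex m \<sigma> as \<in> tuples m A"
  using assms by (auto simp: reindex_def tuples_def subset_iff)

text \<open>The semantic counterpart of a minor of a formula: a preimage under
  \<open>reindex\<close>. It covers permuting and identifying coordinates as well as adding
  inessential ones.\<close>

definition rel_minor :: "'a set \<Rightarrow> nat \<Rightarrow> nat \<Rightarrow> (nat \<Rightarrow> nat) \<Rightarrow> 'a list set \<Rightarrow> 'a list set" where
  "rel_minor A n m \<sigma> B = {as \<in> tuples n A. reindex m \<sigma> as \<in> B}"

lemma Def_n_rel_minor:
  assumes "closed_minor \<Phi>" "1 \<le> m" "\<And>i. i < m \<Longrightarrow> \<sigma> i < n" "B \<in> Def_n m M \<Phi>"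
  shows "rel_minor (univ M) n m \<sigma> B \<in> Def_n n M \<Phi>"
proof -
  from assms(4) obtain p where p: "p \<in> \<Phi>" "fv p \<subseteq> {1..m}" "B = defined_rel M m p"
    by (auto simp: Def_n_def)
  \<comment> \<open>\<open>i - 1\<close> and \<open>Suc\<close> translate between variables and list
    positions; \<open>Suc\<close> also keeps the targets at least 1, as \<open>is_minor\<close>
    demands.\<close>
  define s where "s = (\<lambda>i. if i \<in> {1..m} then Suc (\<sigma> (i - 1)) else i)"
  have "is_minor (subst s p) p"
    unfolding is_minor_def s_def using assms(2) by (intro exI[of _ m] conjI exI) auto
  then have "subst s p \<in> \<Phi>"
    using assms(1) p(1) by (auto simp: closed_minor_def)
  moreover have "fv (subst s p) \<subseteq> {1..n}"
  proof -
    have "Suc (\<sigma> (i - 1)) \<le> n" if "i \<in> {1..m}" for i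
      using assms(3)[of "i - 1"] that by (auto simp: Suc_le_eq)
    then show ?thesis using p(2) by (auto simp: fv_subst s_def)
  qed
  moreover have "rel_minor (univ M) n m \<sigma> B = defined_rel M n (subst s p)"
  proof -
    have "sat M (\<lambda>i. reindex m \<sigma> as ! (i - 1)) p = sat M (\<lambda>i. as ! (i - 1)) (subst s p)" for as
      unfolding sat_subst using p(2) by (intro sat_cong) (auto simp: reindex_def s_def)
    then show ?thesis
      using reindex_tuples[OF assms(3)] p(3) by (auto simp: rel_minor_def defined_rel_def)
  qed
  ultimately show ?thesis unfolding Def_n_def by blast
qed

section \<open>Interpolation in finite lattices of sets\<close>

lemma finite_Inter_closed:
  assumes "finite \<D>" "\<D> \<noteq> {}" "\<D> \<subseteq> \<F>" "\<And>C D. C \<in> \<F> \<Longrightarrow> D \<in> \<F> \<Longrightarrow> C \<inter> D \<in> \<F>"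
  shows "\<Inter>\<D> \<in> \<F>"
  using assms(1-3) by (induction rule: finite_ne_induct) (auto intro: assms(4))

lemma finite_Union_closed:
  assumes "finite \<D>" "\<D> \<noteq> {}" "\<D> \<subseteq> \<F>" "\<And>C D. C \<in> \<F> \<Longrightarrow> D \<in> \<F> \<Longrightarrow> C \<union> D \<in> \<F>"
  shows "\<Union>\<D> \<in> \<F>"
  using assms(1-3) by (induction rule: finite_ne_induct) (auto intro: assms(4))

text \<open>A finite, two-valued form of the lattice version of the Stone-Weierstrass theorem:
  matching \<open>B\<close> at any two points suffices. For fixed \<open>a\<close>, intersecting the
  sets \<open>D a b\<close> over all \<open>b\<close> removes every point outside \<open>B\<close>
  and keeps \<open>a\<close> if \<open>a\<close> lies in \<open>B\<close>.\<close>

lemma set_lattice_interpolation: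
  assumes "finite X" "X \<noteq> {}" "B \<subseteq> X" "\<And>C. C \<in> \<F> \<Longrightarrow> C \<subseteq> X"
    and Int: "\<And>C D. C \<in> \<F> \<Longrightarrow> D \<in> \<F> \<Longrightarrow> C \<inter> D \<in> \<F>"
    and Un: "\<And>C D. C \<in> \<F> \<Longrightarrow> D \<in> \<F> \<Longrightarrow> C \<union> D \<in> \<F>"
    and two_point: "\<And>a b. a \<in> X \<Longrightarrow> b \<in> X \<Longrightarrow> \<exists>D \<in> \<F>. (a \<in> D \<longleftrightarrow> a \<in> B) \<and> (b \<in> D \<longleftrightarrow> b \<in> B)"
  shows "B \<in> \<F>"
proof -
  from two_point obtain D where D: "\<And>a b. a \<in> X \<Longrightarrow> b \<in> X \<Longrightarrow>
      D a b \<in> \<F> \<and> (a \<in> D a b \<longleftrightarrow> a \<in> B) \<and> (b \<in> D a b \<longleftrightarrow> b \<in> B)"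
    by metis
  define E where "E a = \<Inter>(D a ` X)" for a
  have E: "E a \<in> \<F>" if "a \<in> X" for a
    unfolding E_def using assms(1,2) that D by (intro finite_Inter_closed Int) auto
  \<comment> \<open>The union runs over \<open>X\<close> rather than \<open>B\<close>, so that it is
    over a nonempty family even if \<open>B\<close> is empty; each \<open>E a\<close> lies inside
    \<open>B\<close> anyway.\<close>
  have "\<Union>(E ` X) \<in> \<F>"
    using assms(1,2) E by (intro finite_Union_closed Un) auto
  moreover have "\<Union>(E ` X) = B"
  proof
    show "\<Union>(E ` X) \<subseteq> B"
    proof
      fix b assume "b \<in> \<Union>(E ` X)"
      then obtain a where a: "a \<in> X" "b \<in> E a" by blast
      then have "b \<in> X" using E assms(4) by blast
      with a D show "b \<in> B" unfolding E_def by blast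
    qed
    show "B \<subseteq> \<Union>(E ` X)"
      using D assms(3) unfolding E_def by blast
  qed
  ultimately show ?thesis by simp
qed

section \<open>From arity \<open>(card A)\<^sup>2\<close> to every positive arity\<close>

text \<open>Minors in \<open>\<Phi>1\<close> carry a relation to arity
  \<open>(card A)\<^sup>2\<close>, where the assumed inclusion applies. Minors in
  \<open>\<Phi>2\<close> carry it back, and conjunctions and disjunctions there assemble the
  result.\<close>

lemma Def_n_mono_from_card_square:
  assumes "finite A" "A \<noteq> {}" "univ M1 = A" "univ M2 = A"
    and "closed_minor \<Phi>1" "closed_conj \<Phi>2" "closed_disj \<Phi>2" "closed_minor \<Phi>2"
    and sub: "Def_n ((card A)\<^sup>2) M1 \<Phi>1 \<subseteq> Def_n ((card A)\<^sup>2) M2 \<Phi>2" and "1 \<le> n"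
  shows "Def_n n M1 \<Phi>1 \<subseteq> Def_n n M2 \<Phi>2"
proof
  fix B assume B: "B \<in> Def_n n M1 \<Phi>1"
  define k where "k = (card A)\<^sup>2"
  have k: "1 \<le> k" using assms(1,2) by (simp add: k_def Suc_le_eq card_gt_0_iff)
  have "card (A \<times> A) = k" by (simp add: k_def power2_eq_square card_cartesian_product)
  with assms(1) obtain g where g: "bij_betw g (A \<times> A) {0..<k}"
    using ex_bij_betw_finite_nat[of "A \<times> A"] by auto
  show "B \<in> Def_n n M2 \<Phi>2"
  proof (rule set_lattice_interpolation[of "tuples n A"])
    fix a b assume ab: "a \<in> tuples n A" "b \<in> tuples n A"
    then have in_A: "a ! i \<in> A" "b ! i \<in> A" if "i < n" for i
      using that by (auto simp: tuples_def)
    \<comment> \<open>The number of the pair at position \<open>i\<close>: positions with equal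
      pairs are identified.\<close>
    define \<sigma> where "\<sigma> i = g (a ! i, b ! i)" for i
    have \<sigma>: "\<sigma> i < k" if "i < n" for i
      using bij_betwE[OF g] in_A[OF that] by (auto simp: \<sigma>_def)
    \<comment> \<open>A choice of one position for each pair that occurs. The default 0 is
      arbitrary, but it is a valid position because \<open>1 \<le> n\<close>.\<close>
    define \<tau> where "\<tau> j = (if j \<in> \<sigma> ` {..<n} then inv_into {..<n} \<sigma> j else 0)" for j
    have \<tau>: "\<tau> j < n" for j
    proof (cases "j \<in> \<sigma> ` {..<n}")
      case True
      from inv_into_into[OF this] True show ?thesis by (simp only: \<tau>_def if_True lessThan_iff)
    next
      case False
      then show ?thesis using assms(10) by (simp only: \<tau>_def if_False)
    qed
    have \<sigma>\<tau>: "\<sigma> (\<tau> (\<sigma> i)) = \<sigma> i" if "i < n" for i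
    proof -
      have "\<sigma> i \<in> \<sigma> ` {..<n}" using that by (simp only: imageI lessThan_iff)
      from f_inv_into_f[OF this] this show ?thesis by (simp only: \<tau>_def if_True)
    qed
    \<comment> \<open>\<open>g\<close> is injective on pairs, so a position and its chosen
      representative carry the same entries of \<open>a\<close> and of \<open>b\<close>.\<close>
    have same: "a ! \<tau> (\<sigma> i) = a ! i" "b ! \<tau> (\<sigma> i) = b ! i" if "i < n" for i
    proof -
      have "(a ! \<tau> (\<sigma> i), b ! \<tau> (\<sigma> i)) = (a ! i, b ! i)"
      proof (rule inj_onD[OF bij_betw_imp_inj_on[OF g]])
        show "g (a ! \<tau> (\<sigma> i), b ! \<tau> (\<sigma> i)) = g (a ! i, b ! i)"
          using \<sigma>\<tau>[OF that] by (simp only: \<sigma>_def)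
      qed (simp_all add: in_A that \<tau>)
      then show "a ! \<tau> (\<sigma> i) = a ! i" "b ! \<tau> (\<sigma> i) = b ! i" by simp_all
    qed
    \<comment> \<open>The round trip through arity \<open>k\<close> fixes \<open>a\<close> and
      \<open>b\<close>, though not every tuple in general; hence the resulting minor is compared
      with \<open>B\<close> at these two points only.\<close>
    have "reindex n \<sigma> (reindex k \<tau> a) = a" "reindex n \<sigma> (reindex k \<tau> b) = b"
      using ab \<sigma> same by (simp_all add: reindex_def tuples_def list_eq_iff_nth_eq)
    moreover have "reindex k \<tau> a \<in> tuples k A" "reindex k \<tau> b \<in> tuples k A"
      using ab \<tau> by (auto intro: reindex_tuples)
    ultimately have agree: "a \<in> rel_minor A n k \<tau> (rel_minor A k n \<sigma> B) \<longleftrightarrow> a \<in> B"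
      "b \<in> rel_minor A n k \<tau> (rel_minor A k n \<sigma> B) \<longleftrightarrow> b \<in> B"
      using ab by (simp_all add: rel_minor_def)
    have "rel_minor A k n \<sigma> B \<in> Def_n k M1 \<Phi>1"
      using Def_n_rel_minor[OF assms(5,10) \<sigma> B] assms(3) by simp
    then have sub_k: "rel_minor A k n \<sigma> B \<in> Def_n k M2 \<Phi>2"
      using sub by (auto simp: k_def)
    have "rel_minor A n k \<tau> (rel_minor A k n \<sigma> B) \<in> Def_n n M2 \<Phi>2"
      using Def_n_rel_minor[where \<sigma> = \<tau>, OF assms(8) k \<tau> sub_k] assms(4) by simp
    with agree show "\<exists>D \<in> Def_n n M2 \<Phi>2. (a \<in> D \<longleftrightarrow> a \<in> B) \<and> (b \<in> D \<longleftrightarrow> b \<in> B)"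
      by blast
  next
    show "B \<subseteq> tuples n A" using Def_n_subset_tuples[OF B] assms(3) by simp
    show "C \<subseteq> tuples n A" if "C \<in> Def_n n M2 \<Phi>2" for C
      using Def_n_subset_tuples[OF that] assms(4) by simp
    show "C \<inter> D \<in> Def_n n M2 \<Phi>2" "C \<union> D \<in> Def_n n M2 \<Phi>2"
      if "C \<in> Def_n n M2 \<Phi>2" "D \<in> Def_n n M2 \<Phi>2" for C D
      using Def_n_Int[OF assms(6) that] Def_n_Un[OF assms(7) that] by auto
  qed (use assms(1,2) in \<open>simp_all add: finite_tuples tuples_nonempty\<close>)
qed

text \<open>
  The arity of a nonempty relation can be read off its tuples; the empty relation is definable in
  every arity as soon as it is definable in one, being its own minor.
\<close>

lemma Def_n_mono_from_Def:
  assumes "closed_minor \<Phi>2" "Def M1 \<Phi>1 \<subseteq> Def M2 \<Phi>2" "univ M1 = univ M2" "1 \<le> n"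
  shows "Def_n n M1 \<Phi>1 \<subseteq> Def_n n M2 \<Phi>2"
proof
  fix B assume B: "B \<in> Def_n n M1 \<Phi>1"
  then have "B \<in> Def M2 \<Phi>2" using assms(2,4) unfolding Def_def by fastforce
  then obtain m where m: "1 \<le> m" "B \<in> Def_n m M2 \<Phi>2" unfolding Def_def by auto
  show "B \<in> Def_n n M2 \<Phi>2"
  proof (cases "B = {}")
    case True
    \<comment> \<open>Preimages of the empty relation are empty, so any map into the positions below
      \<open>n\<close> serves; 0 is one of them.\<close>
    have "rel_minor (univ M2) n m (\<lambda>_. 0) B \<in> Def_n n M2 \<Phi>2"
      using m assms(1,4) by (intro Def_n_rel_minor) auto
    with True show ?thesis by (simp add: rel_minor_def)
  next
    case False
    then obtain as where "as \<in> B" by blast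
    then have "m = n"
      using Def_n_subset_tuples[OF B] Def_n_subset_tuples[OF m(2)] by (auto simp: tuples_def)
    with m show ?thesis by simp
  qed
qed

theorem theorem3p2:
  fixes A :: "'a set"
    and M1 :: "('a, 'f1, 'r1) fo_struct" and M2 :: "('a, 'f2, 'r2) fo_struct"
    and \<Phi>1 :: "('f1, 'r1) form set" and \<Phi>2 :: "('f2, 'r2) form set"
  assumes "finite A"
    and "is_structure M1" and "univ M1 = A"
    and "is_structure M2" and "univ M2 = A"
    and "\<Phi>1 \<subseteq> formulas M1" and "closed_conj \<Phi>1" and "closed_disj \<Phi>1" and "closed_minor \<Phi>1"
    and "\<Phi>2 \<subseteq> formulas M2" and "closed_conj \<Phi>2" and "closed_disj \<Phi>2" and "closed_minor \<Phi>2"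
  shows "Def M1 \<Phi>1 = Def M2 \<Phi>2 \<longleftrightarrow> Def_n ((card A)\<^sup>2) M1 \<Phi>1 = Def_n ((card A)\<^sup>2) M2 \<Phi>2"
proof
  \<comment> \<open>A nonempty universe makes \<open>(card A)\<^sup>2\<close> positive, hence one of
    the arities collected in \<open>Def\<close>.\<close>
  have A: "A \<noteq> {}" using assms(2,3) by (auto simp: is_structure_def)
  then have k: "1 \<le> (card A)\<^sup>2" using assms(1) by (simp add: Suc_le_eq card_gt_0_iff)
  show "Def_n ((card A)\<^sup>2) M1 \<Phi>1 = Def_n ((card A)\<^sup>2) M2 \<Phi>2" if "Def M1 \<Phi>1 = Def M2 \<Phi>2"
  proof
    show "Def_n ((card A)\<^sup>2) M1 \<Phi>1 \<subseteq> Def_n ((card A)\<^sup>2) M2 \<Phi>2"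
      by (rule Def_n_mono_from_Def[OF assms(13) equalityD1[OF that] _ k]) (simp only: assms(3,5))
    show "Def_n ((card A)\<^sup>2) M2 \<Phi>2 \<subseteq> Def_n ((card A)\<^sup>2) M1 \<Phi>1"
      by (rule Def_n_mono_from_Def[OF assms(9) equalityD2[OF that] _ k]) (simp only: assms(3,5))
  qed
  show "Def M1 \<Phi>1 = Def M2 \<Phi>2" if eq: "Def_n ((card A)\<^sup>2) M1 \<Phi>1 = Def_n ((card A)\<^sup>2) M2 \<Phi>2"
  proof -
    \<comment> \<open>The hypotheses are symmetric in the two structures, so the one-sided lemma
      applies in both directions.\<close>
    have "Def_n n M1 \<Phi>1 = Def_n n M2 \<Phi>2" if "1 \<le> n" for n
    proof
      show "Def_n n M1 \<Phi>1 \<subseteq> Def_n n M2 \<Phi>2"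
        by (rule Def_n_mono_from_card_square[OF assms(1) A assms(3,5,9,11-13)
              equalityD1[OF eq] that])
      show "Def_n n M2 \<Phi>2 \<subseteq> Def_n n M1 \<Phi>1"
        by (rule Def_n_mono_from_card_square[OF assms(1) A assms(5,3,13,7-9)
              equalityD2[OF eq] that])
    qed
    then show ?thesis unfolding Def_def by (intro SUP_cong) auto
  qed
qed

end
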